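(* Let $A$ be an automaton and let $\varphi$ be a robust live execution property for $A$ such that no execution in $\varphi$ contains any state at infinitely many positions. Then there exists a generalized-Büchi condition $\{\mathsf{G}_i\mid i\in\eta\}$ over $A$ ($\eta$ an index set, each $\mathsf{G}_i\subseteq\mathit{states}(A)$) such that $\varphi=\{\gamma\in\mathit{execs}^\omega(A)\mid \forall i\in\eta:\ \gamma\text{ contains states of }\mathsf{G}_i\text{ at infinitely many positions}\}$.
   Context: An automaton $A$ has a set of states $\mathit{states}(A)$, nonempty start states, actions, and a transition relation $\mathit{steps}(A)\subseteq\mathit{states}(A)\times\mathit{acts}(A)\times\mathit{states}(A)$. An execution is a finite or infinite alternating sequence $s_0a_1s_1\ldots$ starting in a start state with each $(s_i,a_{i+1},s_{i+1})\in\mathit{steps}(A)$ (ending in a state if finite); $\alpha<\alpha'$ means proper prefix; $\mathit{execs}^\omega(A)$ is the set of infinite executions. A live execution property for $A$ is a set $\varphi\subseteq\mathit{execs}^\omega(A)$ such that every finite execution $\alpha$ of $A$ has some $\alpha'\in\varphi$ with $\alpha<\alpha'$. For infinite executions $\alpha=s_0a_1s_1\ldots$ and $\gamma$, write $\gamma\lhd\alpha$ iff there exist a suffix $u_0b_1u_1\ldots$ of $\gamma$ and a map $m:\mathbb{N}\to\mathbb{N}$ with $s_{m(i)}=u_i$ for all $i$ and $m^{-1}(i)$ finite for all $i$. A live execution property $\varphi$ is robust if for all $\gamma,\alpha\in\mathit{execs}^\omega(A)$, $\gamma\lhd\alpha$ and $\gamma\in\varphi$ imply $\alpha\in\varphi$.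 A generalized-Büchi condition over $A$ is a family of subsets of $\mathit{states}(A)$. *)

theory Defs
  imports Main
begin

record ('s, 'a) automaton =
  states :: "'s set"
  start :: "'s set"
  acts :: "'a set"
  steps :: "('s \<times> 'a \<times> 's) set"

definition is_automaton :: "('s, 'a) automaton \<Rightarrow> bool" where
  "is_automaton A \<longleftrightarrow>
     start A \<noteq> {} \<and> start A \<subseteq> states A \<and> steps A \<subseteq> states A \<times> acts A \<times> states A"

text \<open>
  An alternating sequence s0 a1 s1 a2 s2 ... is stored as its states and its actions separately.
  States are indexed from 0; the action at index i is the one between the states at
  indices i and i + 1. A finite sequence ends in a state, so it has one more state than actions.
\<close>

datatype ('s, 'a) fin_seq = Fin_Seq (fin_states: "'s list") (fin_acts: "'a list")

datatype ('s, 'a) inf_seq = Inf_Seq (state_at: "nat \<Rightarrow> 's") (act_at: "nat \<Rightarrow> 'a")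

definition fin_execs :: "('s, 'a) automaton \<Rightarrow> ('s, 'a) fin_seq set" where
  "fin_execs A = {\<alpha>. length (fin_states \<alpha>) = Suc (length (fin_acts \<alpha>)) \<and>
     fin_states \<alpha> ! 0 \<in> start A \<and>
     (\<forall>i < length (fin_acts \<alpha>).
        (fin_states \<alpha> ! i, fin_acts \<alpha> ! i, fin_states \<alpha> ! Suc i) \<in> steps A)}"

definition inf_execs :: "('s, 'a) automaton \<Rightarrow> ('s, 'a) inf_seq set" where
  "inf_execs A = {\<alpha>. state_at \<alpha> 0 \<in> start A \<and>
     (\<forall>i. (state_at \<alpha> i, act_at \<alpha> i, state_at \<alpha> (Suc i)) \<in> steps A)}"

text \<open>A prefix relation between a finite and an infinite sequence is always proper.\<close>

definition proper_prefix :: "('s, 'a) fin_seq \<Rightarrow> ('s, 'a) inf_seq \<Rightarrow> bool" where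
  "proper_prefix \<alpha> \<alpha>' \<longleftrightarrow>
     (\<forall>i < length (fin_states \<alpha>). fin_states \<alpha> ! i = state_at \<alpha>' i) \<and>
     (\<forall>i < length (fin_acts \<alpha>). fin_acts \<alpha> ! i = act_at \<alpha>' i)"

definition live_execution_property ::
    "('s, 'a) automaton \<Rightarrow> ('s, 'a) inf_seq set \<Rightarrow> bool" where
  "live_execution_property A \<phi> \<longleftrightarrow>
     \<phi> \<subseteq> inf_execs A \<and> (\<forall>\<alpha> \<in> fin_execs A. \<exists>\<alpha>' \<in> \<phi>. proper_prefix \<alpha> \<alpha>')"

definition suffix_from :: "nat \<Rightarrow> ('s, 'a) inf_seq \<Rightarrow> ('s, 'a) inf_seq" where
  "suffix_from k \<gamma> = Inf_Seq (\<lambda>i. state_at \<gamma> (k + i)) (\<lambda>i. act_at \<gamma> (k + i))"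

text \<open>The map \<open>m\<close> need not be monotone.\<close>

definition embeds :: "('s, 'a) inf_seq \<Rightarrow> ('s, 'a) inf_seq \<Rightarrow> bool" (infix "\<lhd>\<^sub>e" 50) where
  "\<gamma> \<lhd>\<^sub>e \<alpha> \<longleftrightarrow>
     (\<exists>k. \<exists>m :: nat \<Rightarrow> nat.
        (\<forall>i. state_at \<alpha> (m i) = state_at (suffix_from k \<gamma>) i) \<and>
        (\<forall>i. finite (m -` {i})))"

definition robust :: "('s, 'a) automaton \<Rightarrow> ('s, 'a) inf_seq set \<Rightarrow> bool" where
  "robust A \<phi> \<longleftrightarrow>
     (\<forall>\<gamma> \<in> inf_execs A. \<forall>\<alpha> \<in> inf_execs A. \<gamma> \<lhd>\<^sub>e \<alpha> \<and> \<gamma> \<in> \<phi> \<longrightarrow> \<alpha> \<in> \<phi>)"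

definition visits_infinitely_often :: "('s, 'a) inf_seq \<Rightarrow> 's set \<Rightarrow> bool" where
  "visits_infinitely_often \<gamma> G \<longleftrightarrow> infinite {i. state_at \<gamma> i \<in> G}"

text \<open>
  Only the collection of the sets \<open>G i\<close> matters for acceptance, so the index type \<open>'s set\<close> is
  enough to represent a condition over an arbitrary index set, up to re-indexing.
\<close>

definition generalized_buchi_condition ::
    "('s, 'a) automaton \<Rightarrow> 'i set \<Rightarrow> ('i \<Rightarrow> 's set) \<Rightarrow> bool" where
  "generalized_buchi_condition A \<eta> G \<longleftrightarrow> (\<forall>i \<in> \<eta>. G i \<subseteq> states A)"

end

(* Take as Buchi sets all G that every execution of phi visits infinitely often. An execution
   alpha outside phi is rejected by the set G of states not occurring in alpha: if some gamma in phi
   visited G only finitely often, then a suffix of gamma would use only states of alpha, and since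
   gamma repeats each state finitely often, any choice of positions would embed that suffix in alpha,
   so robustness would put alpha into phi. *)
theory Submission imports Defs begin

lemma inf_execs_state_at:
  assumes "is_automaton A" and "\<alpha> \<in> inf_execs A"
  shows "state_at \<alpha> i \<in> states A"
  using assms unfolding is_automaton_def inf_execs_def by blast

text \<open>From some position on, every state of \<gamma> occurs in \<alpha>, so positions in
  \<alpha> can be chosen freely: indices sent to the same position share a state, and
  \<open>rep\<close> makes each fibre finite.\<close>

lemma embeds_if_finitely_many_outside:
  assumes fin: "finite {i. state_at \<gamma> i \<notin> range (state_at \<alpha>)}"
    and rep: "\<And>s. finite {i. state_at \<gamma> i = s}"
  shows "\<gamma> \<lhd>\<^sub>e \<alpha>"
proof -
  obtain k where k: "\<And>i. i \<in> {i. state_at \<gamma> i \<notin> range (state_at \<alpha>)} \<Longrightarrow> i < k"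
    using fin unfolding finite_nat_set_iff_bounded by blast
  have "\<exists>j. state_at \<alpha> j = state_at \<gamma> (k + i)" for i
    using k[of "k + i"] by (fastforce simp: image_iff)
  then obtain m where m: "\<And>i. state_at \<alpha> (m i) = state_at \<gamma> (k + i)"
    by metis
  have "finite (m -` {j})" for j
  proof -
    have "m -` {j} \<subseteq> (+) k -` {i. state_at \<gamma> i = state_at \<alpha> j}"
      using m by auto
    moreover have "finite ((+) k -` {i. state_at \<gamma> i = state_at \<alpha> j})"
      by (intro finite_vimageI rep) simp
    ultimately show ?thesis
      by (rule finite_subset)
  qed
  then show ?thesis
    unfolding embeds_def suffix_from_def using m by auto
qed

theorem theorem14:
  fixes A :: "('s, 'a) automaton"
    and \<phi> :: "('s, 'a) inf_seq set"
  assumes "is_automaton A"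
    and "live_execution_property A \<phi>"
    and "robust A \<phi>"
    and "\<forall>\<gamma> \<in> \<phi>. \<forall>s \<in> states A. \<not> infinite {i. state_at \<gamma> i = s}"
  shows "\<exists>(\<eta> :: 's set set) (G :: 's set \<Rightarrow> 's set).
    generalized_buchi_condition A \<eta> G \<and>
    \<phi> = {\<gamma> \<in> inf_execs A. \<forall>i \<in> \<eta>. visits_infinitely_often \<gamma> (G i)}"
proof -
  \<comment> \<open>The largest family of Buchi sets compatible with \<phi>; only the inclusion into
    \<phi> then needs an argument.\<close>
  define \<eta> where "\<eta> = {G. G \<subseteq> states A \<and> (\<forall>\<gamma> \<in> \<phi>. visits_infinitely_often \<gamma> G)}"
  have sub: "\<phi> \<subseteq> inf_execs A"
    using assms(2) by (simp add: live_execution_property_def)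
  have rep: "finite {i. state_at \<gamma> i = s}" if "\<gamma> \<in> \<phi>" for \<gamma> s
  proof (cases "s \<in> states A")
    case True
    then show ?thesis using assms(4) that by blast
  next
    case False
    then have "{i. state_at \<gamma> i = s} = {}"
      using inf_execs_state_at[OF assms(1)] sub that by blast
    then show ?thesis by simp
  qed
  have "\<alpha> \<in> \<phi>" if \<alpha>: "\<alpha> \<in> inf_execs A" and vis: "\<forall>G \<in> \<eta>. visits_infinitely_often \<alpha> G" for \<alpha>
  proof -
    \<comment> \<open>Being a subset of \<open>states A\<close>, \<open>?G\<close> can be missing
      from \<open>\<eta>\<close> only because some \<gamma> in \<phi> visits it finitely
      often.\<close>
    let ?G = "states A - range (state_at \<alpha>)"
    have "\<not> visits_infinitely_often \<alpha> ?G"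
      by (simp add: visits_infinitely_often_def)
    then have "?G \<notin> \<eta>"
      using vis by blast
    then obtain \<gamma> where \<gamma>: "\<gamma> \<in> \<phi>" and "\<not> visits_infinitely_often \<gamma> ?G"
      unfolding \<eta>_def by blast
    \<comment> \<open>Since \<gamma> stays in \<open>states A\<close>, its states outside
      \<open>?G\<close> are exactly those occurring in \<alpha>.\<close>
    then have "finite {i. state_at \<gamma> i \<notin> range (state_at \<alpha>)}"
      using inf_execs_state_at[OF assms(1)] sub by (auto simp: visits_infinitely_often_def)
    then have "\<gamma> \<lhd>\<^sub>e \<alpha>"
      using rep[OF \<gamma>] by (rule embeds_if_finitely_many_outside)
    then show ?thesis
      using assms(3) \<alpha> \<gamma> sub unfolding robust_def by blast
  qed
  \<comment> \<open>Each Buchi set serves as its own index, hence \<open>id\<close>.\<close>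
  then have "\<phi> = {\<gamma> \<in> inf_execs A. \<forall>G \<in> \<eta>. visits_infinitely_often \<gamma> (id G)}"
    using sub unfolding \<eta>_def by auto
  moreover have "generalized_buchi_condition A \<eta> id"
    by (simp add: generalized_buchi_condition_def \<eta>_def)
  ultimately show ?thesis by blast
qed

end
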